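(* Let $X=(X_1,\dots,X_n)$ be an $\mathbf{E}^n$-valued random vector with independent components, let $\alpha=(\alpha_1,\dots,\alpha_n)\in[0,\infty)^n$ satisfy $\|\alpha\|=1$, and let $f:\mathbf{E}^n\to\mathbb{R}$ be a measurable function such that $|f(x)-f(x')|\le d_\alpha(x,x')$ for all $x,x'\in\mathbf{E}^n$. Let $m$ be a median of $f(X)$, let $\mu=\mathbb{E}[f(X)]$, and let $\rho=\mathbb{E}[d_\alpha(X,A)]$ with $A=\{y\in\mathbf{E}^n: f(y)\le m\}$. Then $$|\mu-m|\le\big(2\rho+\sqrt{\pi/2}\,\big)e^{-2\rho^2}<1.5503.$$
   Context: $n\ge1$, $\mathbf{E}$ is a (separable) space equipped with a $\sigma$-algebra, and $\mathbf{E}^n$ carries the product $\sigma$-algebra. For $\alpha\in[0,\infty)^n$, $\|\alpha\|=(\sum_{i=1}^n\alpha_i^2)^{1/2}$. For $x,y\in\mathbf{E}^n$ the $\alpha$-Hamming distance is $d_\alpha(x,y)=\sum_{i:\,x_i\ne y_i}\alpha_i$, and for $A\subset\mathbf{E}^n$, $d_\alpha(x,A)=\inf_{y\in A}d_\alpha(x,y)$. Standing assumption: the functions $d_\alpha(\cdot,A)$ considered are measurable. A median of $f(X)$ is a real number $m$ with $\mathbb{P}(f(X)\ge m)\ge\frac12$ and $\mathbb{P}(f(X)\le m)\ge\frac12$. *)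

theory Defs
  imports "HOL-Probability.Probability"
begin

text \<open>
  The space \<open>\<^bold>E\<close> with its sigma-algebra is a measure \<open>E :: 'e measure\<close> of which only
  the carrier and the measurable sets matter, and \<open>\<^bold>E\<close> to the power \<open>n\<close> is \<open>power_space n E\<close>,
  whose points are the extensional functions from \<open>{1..n}\<close> to \<open>space E\<close>.
\<close>

abbreviation power_space :: "nat \<Rightarrow> 'e measure \<Rightarrow> (nat \<Rightarrow> 'e) measure" where
  "power_space n E \<equiv> Pi\<^sub>M {1..n} (\<lambda>_. E)"

definition hamming_dist :: "nat \<Rightarrow> (nat \<Rightarrow> real) \<Rightarrow> (nat \<Rightarrow> 'e) \<Rightarrow> (nat \<Rightarrow> 'e) \<Rightarrow> real" where
  "hamming_dist n \<alpha> x y = (\<Sum>i | i \<in> {1..n} \<and> x i \<noteq> y i. \<alpha> i)"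

text \<open>Only meaningful for nonempty \<open>A\<close>: the real infimum of the empty set is not infinite.\<close>

definition hamming_setdist :: "nat \<Rightarrow> (nat \<Rightarrow> real) \<Rightarrow> (nat \<Rightarrow> 'e) \<Rightarrow> (nat \<Rightarrow> 'e) set \<Rightarrow> real" where
  "hamming_setdist n \<alpha> x A = (INF y\<in>A. hamming_dist n \<alpha> x y)"

definition is_median :: "'w measure \<Rightarrow> ('w \<Rightarrow> real) \<Rightarrow> real \<Rightarrow> bool" where
  "is_median M Y m \<longleftrightarrow>
     measure M {\<omega> \<in> space M. Y \<omega> \<ge> m} \<ge> 1 / 2 \<and> measure M {\<omega> \<in> space M. Y \<omega> \<le> m} \<ge> 1 / 2"

end

theory Submission
  imports Defs
begin

text \<open>
  By McDiarmid's inequality a function \<open>h\<close> that is 1-Lipschitz for \<open>d\<^sub>\<alpha>\<close> and satisfies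
  \<open>P (h(X) \<ge> a) \<ge> 1/2\<close> with \<open>a \<ge> E h(X)\<close> has \<open>exp (- 2 (a - E h(X))\<^sup>2) \<ge> 1/2\<close>.
  For \<open>h = f\<close> and \<open>h = - f\<close> this gives \<open>2 (\<mu> - m)\<^sup>2 \<le> ln 2\<close>; for \<open>h = - d\<^sub>\<alpha>(\<cdot>, A)\<close>
  and \<open>a = 0\<close> it gives \<open>exp (- 2 \<rho>\<^sup>2) \<ge> 1/2\<close>. As \<open>sqrt (ln 2 / 2) < sqrt (\<pi> / 2) / 2\<close>,
  the first inequality follows with room to spare; the second one holds for every real \<open>\<rho>\<close>.
\<close>

section \<open>McDiarmid's inequality\<close>

text \<open>Oscillation at most \<open>c\<close> confines \<open>g\<close> to the interval of length
  \<open>c\<close> that starts at its infimum, and Hoeffding's lemma for bounded variables applies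
  there.\<close>

lemma (in prob_space) Hoeffding_lemma_oscillation:
  fixes g :: "'a \<Rightarrow> real"
  assumes meas: "g \<in> borel_measurable M"
    and osc: "\<And>x y. x \<in> space M \<Longrightarrow> y \<in> space M \<Longrightarrow> \<bar>g x - g y\<bar> \<le> c"
    and "l > 0"
  shows "(\<integral>\<^sup>+x. ennreal (exp (l * (g x - expectation g))) \<partial>M) \<le> ennreal (exp (l\<^sup>2 * c\<^sup>2 / 8))"
proof -
  obtain x0 where x0: "x0 \<in> space M"
    using not_empty by blast
  define a where "a = (INF x\<in>space M. g x)"
  have bdd: "bdd_below (g ` space M)"
    by (rule bdd_belowI2[where m = "g x0 - c"]) (use osc[OF x0] in \<open>auto simp: abs_le_iff algebra_simps\<close>)
  have "g x \<in> {a..a + c}" if x: "x \<in> space M" for x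
  proof -
    have "g x - c \<le> a"
      unfolding a_def using not_empty
      by (intro cINF_greatest) (use osc[OF x] in \<open>auto simp: abs_le_iff algebra_simps\<close>)
    moreover have "a \<le> g x"
      unfolding a_def by (rule cINF_lower[OF bdd x])
    ultimately show ?thesis by auto
  qed
  then interpret interval_bounded_random_variable M g a "a + c"
    by unfold_locales (use meas in auto)
  show ?thesis
    using Hoeffdings_lemma_nn_integral[OF \<open>l > 0\<close>] by simp
qed

text \<open>The expectation over one coordinate keeps the Lipschitz constants of the other coordinates,
  so the coordinates can be integrated out one at a time.\<close>

lemma (in product_prob_space) nn_integral_exp_PiM_le:
  fixes f :: "('i \<Rightarrow> 'a) \<Rightarrow> real"
  assumes "finite J" and "l > 0"
    and c: "\<And>i. i \<in> J \<Longrightarrow> 0 \<le> c i"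
    and meas: "f \<in> borel_measurable (PiM J M)"
    and lip: "\<And>x y. x \<in> space (PiM J M) \<Longrightarrow> y \<in> space (PiM J M) \<Longrightarrow>
            \<bar>f x - f y\<bar> \<le> (\<Sum>i | i \<in> J \<and> x i \<noteq> y i. c i)"
  shows "(\<integral>\<^sup>+x. ennreal (exp (l * (f x - integral\<^sup>L (PiM J M) f))) \<partial>PiM J M)
           \<le> ennreal (exp (l\<^sup>2 * (\<Sum>i\<in>J. (c i)\<^sup>2) / 8))"
  using assms(1) c meas lip
proof (induction J arbitrary: f rule: finite_induct)
  case empty
  \<comment> \<open>The empty product has \<open>\<lambda>_. undefined\<close> as its only point, so
    both sides of the claim equal 1.\<close>
  have "integral\<^sup>L (PiM {} M) f = f (\<lambda>_. undefined)"
    by (simp add: PiM_empty lebesgue_integral_count_space_finite)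
  then show ?case
    by (simp add: nn_integral_empty)
next
  case (insert i J f)
  note [measurable] = insert.prems(2)
  interpret PJ: prob_space "PiM J M" by (rule prob_space_PiM) (rule M.prob_space_axioms)
  interpret PI: prob_space "PiM (insert i J) M"
    by (rule prob_space_PiM) (rule M.prob_space_axioms)
  define g where "g x = (\<integral>y. f (x(i := y)) \<partial>M i)" for x
  have upd: "x(i := y) \<in> space (PiM (insert i J) M)"
    if "x \<in> space (PiM J M)" "y \<in> space (M i)" for x y
    using that by (auto simp: space_PiM PiE_iff extensional_def)
  have meas_pair: "(\<lambda>(x, y). f (x(i := y))) \<in> borel_measurable (PiM J M \<Otimes>\<^sub>M M i)"
    by measurable
  have meas_slice: "(\<lambda>y. f (x(i := y))) \<in> borel_measurable (M i)" if "x \<in> space (PiM J M)" for x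
    using measurable_compose[OF measurable_Pair1' [OF that] meas_pair] by simp
  have meas_g [measurable]: "g \<in> borel_measurable (PiM J M)"
    unfolding g_def using meas_pair by (intro M.borel_measurable_lebesgue_integral) auto
  \<comment> \<open>Finitely many coordinates make a Lipschitz function bounded; both integrability
    facts below come from this.\<close>
  have bound: "\<bar>f x - f y\<bar> \<le> (\<Sum>j\<in>insert i J. c j)"
    if "x \<in> space (PiM (insert i J) M)" "y \<in> space (PiM (insert i J) M)" for x y
    using insert.prems(1) insert.hyps(1)
    by (intro order_trans[OF insert.prems(3)[OF that]] sum_mono2) auto
  have integrable_f: "integrable (PiM (insert i J) M) f"
  proof -
    obtain x0 where x0: "x0 \<in> space (PiM (insert i J) M)"
      using PI.not_empty by blast
    have "norm (f x) \<le> \<bar>f x0\<bar> + (\<Sum>j\<in>insert i J. c j)"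
      if "x \<in> space (PiM (insert i J) M)" for x
      using bound[OF that x0] by (simp del: sum.insert)
    then show ?thesis
      by (intro PI.integrable_const_bound[OF AE_I2] insert.prems(2))
  qed
  have integrable_slice: "integrable (M i) (\<lambda>y. f (x(i := y)))" if x: "x \<in> space (PiM J M)" for x
  proof -
    obtain y0 where y0: "y0 \<in> space (M i)"
      using M.not_empty by blast
    have "norm (f (x(i := y))) \<le> \<bar>f (x(i := y0))\<bar> + (\<Sum>j\<in>insert i J. c j)"
      if "y \<in> space (M i)" for y
      using bound[OF upd[OF x that] upd[OF x y0]] by (simp del: sum.insert)
    then show ?thesis
      by (intro M.integrable_const_bound[OF AE_I2] meas_slice[OF x])
  qed
  have int_g: "integral\<^sup>L (PiM (insert i J) M) f = integral\<^sup>L (PiM J M) g"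
    unfolding g_def using insert.hyps integrable_f by (rule product_integral_insert)
  have lip_g: "\<bar>g x - g x'\<bar> \<le> (\<Sum>j | j \<in> J \<and> x j \<noteq> x' j. c j)"
    if x: "x \<in> space (PiM J M)" and x': "x' \<in> space (PiM J M)" for x x'
  proof -
    have "\<bar>g x - g x'\<bar> = \<bar>\<integral>y. f (x(i := y)) - f (x'(i := y)) \<partial>M i\<bar>"
      unfolding g_def using integrable_slice[OF x] integrable_slice[OF x'] by simp
    also have "\<dots> \<le> (\<integral>y. \<bar>f (x(i := y)) - f (x'(i := y))\<bar> \<partial>M i)"
      by (rule integral_abs_bound)
    also have "\<dots> \<le> (\<integral>y. (\<Sum>j | j \<in> J \<and> x j \<noteq> x' j. c j) \<partial>M i)"
    proof (rule integral_mono)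
      show "integrable (M i) (\<lambda>y. \<bar>f (x(i := y)) - f (x'(i := y))\<bar>)"
        using integrable_slice[OF x] integrable_slice[OF x'] by auto
      fix y assume y: "y \<in> space (M i)"
      \<comment> \<open>Both points carry the same \<open>y\<close> at \<open>i\<close>, so
        \<open>c i\<close> does not enter the bound for \<open>g\<close>.\<close>
      have "{j. j \<in> insert i J \<and> (x(i := y)) j \<noteq> (x'(i := y)) j} = {j. j \<in> J \<and> x j \<noteq> x' j}"
        using insert.hyps(2) by auto
      then show "\<bar>f (x(i := y)) - f (x'(i := y))\<bar> \<le> (\<Sum>j | j \<in> J \<and> x j \<noteq> x' j. c j)"
        using insert.prems(3)[OF upd[OF x y] upd[OF x' y]] by (simp only:)
    qed auto
    also have "\<dots> = (\<Sum>j | j \<in> J \<and> x j \<noteq> x' j. c j)"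
      by (simp add: M.prob_space)
    finally show ?thesis .
  qed
  \<comment> \<open>For fixed \<open>x\<close> only coordinate \<open>i\<close> moves, so the
    oscillation is at most \<open>c i\<close>, and the mean over that coordinate is
    \<open>g x\<close>.\<close>
  have slice: "(\<integral>\<^sup>+y. ennreal (exp (l * (f (x(i := y)) - g x))) \<partial>M i) \<le> ennreal (exp (l\<^sup>2 * (c i)\<^sup>2 / 8))"
    if x: "x \<in> space (PiM J M)" for x
    unfolding g_def
  proof (rule M.Hoeffding_lemma_oscillation[OF meas_slice[OF x] _ \<open>l > 0\<close>])
    fix y z assume yz: "y \<in> space (M i)" "z \<in> space (M i)"
    have "\<bar>f (x(i := y)) - f (x(i := z))\<bar> \<le> (\<Sum>j | j \<in> insert i J \<and> (x(i := y)) j \<noteq> (x(i := z)) j. c j)"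
      using insert.prems(3) upd x yz by blast
    also have "\<dots> \<le> (\<Sum>j\<in>{i}. c j)"
      using insert.prems(1) by (intro sum_mono2) auto
    finally show "\<bar>f (x(i := y)) - f (x(i := z))\<bar> \<le> c i" by simp
  qed
  define I where "I = integral\<^sup>L (PiM J M) g"
  have "(\<integral>\<^sup>+x. ennreal (exp (l * (f x - I))) \<partial>PiM (insert i J) M)
      = (\<integral>\<^sup>+x. (\<integral>\<^sup>+y. ennreal (exp (l * (f (x(i := y)) - I))) \<partial>M i) \<partial>PiM J M)"
    using insert.hyps by (intro product_nn_integral_insert) auto
  \<comment> \<open>The exponent splits as \<open>(g x - I) + (f (x(i := y)) - g x)\<close>: the
    first summand is constant in \<open>y\<close>, the second is controlled by \<open>slice\<close>.
    The induction hypothesis for \<open>g\<close> then handles the outer integral.\<close>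
  also have "\<dots> = (\<integral>\<^sup>+x. ennreal (exp (l * (g x - I))) *
                     (\<integral>\<^sup>+y. ennreal (exp (l * (f (x(i := y)) - g x))) \<partial>M i) \<partial>PiM J M)"
  proof (rule nn_integral_cong)
    fix x assume x: "x \<in> space (PiM J M)"
    note [measurable] = meas_slice[OF x]
    have "(\<integral>\<^sup>+y. ennreal (exp (l * (f (x(i := y)) - I))) \<partial>M i) =
          (\<integral>\<^sup>+y. ennreal (exp (l * (g x - I))) * ennreal (exp (l * (f (x(i := y)) - g x))) \<partial>M i)"
      by (intro nn_integral_cong) (simp add: algebra_simps flip: ennreal_mult exp_add)
    also have "\<dots> = ennreal (exp (l * (g x - I))) *
                      (\<integral>\<^sup>+y. ennreal (exp (l * (f (x(i := y)) - g x))) \<partial>M i)"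
      by (rule nn_integral_cmult) measurable
    finally show "(\<integral>\<^sup>+y. ennreal (exp (l * (f (x(i := y)) - I))) \<partial>M i) = \<dots>" .
  qed
  also have "\<dots> \<le> (\<integral>\<^sup>+x. ennreal (exp (l * (g x - I))) * ennreal (exp (l\<^sup>2 * (c i)\<^sup>2 / 8)) \<partial>PiM J M)"
    by (intro nn_integral_mono mult_left_mono slice) auto
  also have "\<dots> = (\<integral>\<^sup>+x. ennreal (exp (l * (g x - I))) \<partial>PiM J M) * ennreal (exp (l\<^sup>2 * (c i)\<^sup>2 / 8))"
    by (rule nn_integral_multc) measurable
  also have "\<dots> \<le> ennreal (exp (l\<^sup>2 * (\<Sum>j\<in>J. (c j)\<^sup>2) / 8)) * ennreal (exp (l\<^sup>2 * (c i)\<^sup>2 / 8))"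
    unfolding I_def using insert.prems(1) lip_g
    by (intro mult_right_mono insert.IH meas_g) auto
  also have "\<dots> = ennreal (exp (l\<^sup>2 * (\<Sum>j\<in>insert i J. (c j)\<^sup>2) / 8))"
    using insert.hyps by (simp add: algebra_simps add_divide_distrib flip: ennreal_mult exp_add)
  finally show ?case
    unfolding int_g I_def .
qed

text \<open>Chernoff's method: Markov's inequality for \<open>exp (l * (f x - I))\<close>, the
  exponential moment bound above, and the best choice of \<open>l\<close>.\<close>

theorem (in product_prob_space) McDiarmid_inequality:
  fixes f :: "('i \<Rightarrow> 'a) \<Rightarrow> real"
  assumes "finite J"
    and c: "\<And>i. i \<in> J \<Longrightarrow> 0 \<le> c i" and pos: "(\<Sum>i\<in>J. (c i)\<^sup>2) > 0"
    and meas: "f \<in> borel_measurable (PiM J M)"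
    and lip: "\<And>x y. x \<in> space (PiM J M) \<Longrightarrow> y \<in> space (PiM J M) \<Longrightarrow>
            \<bar>f x - f y\<bar> \<le> (\<Sum>i | i \<in> J \<and> x i \<noteq> y i. c i)"
    and "t \<ge> 0"
  shows "measure (PiM J M) {x \<in> space (PiM J M). f x \<ge> integral\<^sup>L (PiM J M) f + t}
           \<le> exp (- 2 * t\<^sup>2 / (\<Sum>i\<in>J. (c i)\<^sup>2))"
\<comment> \<open>At \<open>t = 0\<close> the bound is 1; the parameter \<open>l\<close> chosen
  below would be 0, but the moment bound requires \<open>l > 0\<close>.\<close>
proof (cases "t = 0")
  case True
  interpret Q: prob_space "PiM J M" by (rule prob_space_PiM) (rule M.prob_space_axioms)
  show ?thesis using True by simp
next
  case False
  interpret Q: prob_space "PiM J M" by (rule prob_space_PiM) (rule M.prob_space_axioms)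
  note [measurable] = meas
  define d where "d = (\<Sum>i\<in>J. (c i)\<^sup>2)"
  \<comment> \<open>This minimises the exponent \<open>l\<^sup>2 * d / 8 - l * t\<close>, with
    minimum \<open>- 2 * t\<^sup>2 / d\<close>.\<close>
  define l where "l = 4 * t / d"
  define I where "I = integral\<^sup>L (PiM J M) f"
  have d: "d > 0" using pos by (simp add: d_def)
  have l: "l > 0" using d False \<open>t \<ge> 0\<close> by (simp add: l_def)
  have "ennreal (Q.prob {x \<in> space (PiM J M). f x \<ge> I + t})
      = emeasure (PiM J M) {x \<in> space (PiM J M). f x - I \<ge> t}"
    by (simp add: Q.emeasure_eq_measure algebra_simps)
  also have "\<dots> \<le> ennreal (exp (- l * t)) * (\<integral>\<^sup>+x\<in>space (PiM J M). exp (l * (f x - I)) \<partial>PiM J M)"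
    by (intro Chernoff_ineq_nn_integral_ge l) auto
  also have "(\<integral>\<^sup>+x\<in>space (PiM J M). exp (l * (f x - I)) \<partial>PiM J M)
      = (\<integral>\<^sup>+x. exp (l * (f x - I)) \<partial>PiM J M)"
    by (intro nn_integral_cong) auto
  also have "ennreal (exp (- l * t)) * \<dots> \<le> ennreal (exp (- l * t)) * ennreal (exp (l\<^sup>2 * d / 8))"
    unfolding I_def d_def
    by (intro mult_left_mono nn_integral_exp_PiM_le[OF \<open>finite J\<close> l c meas lip]) auto
  also have "\<dots> = ennreal (exp (l\<^sup>2 * d / 8 - l * t))"
    by (simp add: algebra_simps flip: ennreal_mult exp_add)
  also have "l\<^sup>2 * d / 8 - l * t = - 2 * t\<^sup>2 / d"
    using d by (simp add: l_def field_simps power2_eq_square)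
  finally show ?thesis
    by (simp add: I_def d_def)
qed

text \<open>McDiarmid's inequality read backwards: an upper tail of mass at least 1/2 cannot start
  far above the mean.\<close>

lemma (in product_prob_space) exp_ge_half_of_Lipschitz:
  fixes h :: "('i \<Rightarrow> 'a) \<Rightarrow> real"
  assumes "finite J" "\<And>i. i \<in> J \<Longrightarrow> 0 \<le> c i" "L2_set c J = 1"
    and meas: "h \<in> borel_measurable (PiM J M)"
    and "\<And>x y. x \<in> space (PiM J M) \<Longrightarrow> y \<in> space (PiM J M) \<Longrightarrow>
            \<bar>h x - h y\<bar> \<le> (\<Sum>i | i \<in> J \<and> x i \<noteq> y i. c i)"
    and half: "measure (PiM J M) {x \<in> space (PiM J M). h x \<ge> a} \<ge> 1 / 2"
    and "a \<ge> integral\<^sup>L (PiM J M) h"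
  shows "exp (- 2 * (a - integral\<^sup>L (PiM J M) h)\<^sup>2) \<ge> 1 / 2"
proof -
  have "(\<Sum>i\<in>J. (c i)\<^sup>2) = 1"
    using \<open>L2_set c J = 1\<close> by (simp add: L2_set_def)
  with McDiarmid_inequality[of J c h "a - integral\<^sup>L (PiM J M) h"] assms
  show ?thesis by simp
qed

section \<open>Hamming distances\<close>

lemma hamming_dist_nonneg:
  assumes "\<And>i. i \<in> {1..n} \<Longrightarrow> 0 \<le> \<alpha> i"
  shows "0 \<le> hamming_dist n \<alpha> x y"
  unfolding hamming_dist_def using assms by (intro sum_nonneg) auto

lemma hamming_dist_commute: "hamming_dist n \<alpha> x y = hamming_dist n \<alpha> y x"
  unfolding hamming_dist_def by (rule sum.cong) auto

lemma hamming_dist_triangle: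
  assumes \<alpha>: "\<And>i. i \<in> {1..n} \<Longrightarrow> 0 \<le> \<alpha> i"
  shows "hamming_dist n \<alpha> x z \<le> hamming_dist n \<alpha> x y + hamming_dist n \<alpha> y z"
proof -
  let ?D = "\<lambda>x y. {i. i \<in> {1..n} \<and> x i \<noteq> y i}"
  have "sum \<alpha> (?D x z) \<le> sum \<alpha> (?D x y \<union> ?D y z)"
    using \<alpha> by (intro sum_mono2) auto
  also have "\<dots> \<le> sum \<alpha> (?D x y) + sum \<alpha> (?D y z)"
    using \<alpha> by (subst sum_Un) (auto intro!: sum_nonneg)
  finally show ?thesis unfolding hamming_dist_def .
qed

lemma hamming_setdist_lower:
  assumes "\<And>i. i \<in> {1..n} \<Longrightarrow> 0 \<le> \<alpha> i" "y \<in> A"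
  shows "hamming_setdist n \<alpha> x A \<le> hamming_dist n \<alpha> x y"
  unfolding hamming_setdist_def
  using assms by (intro cINF_lower bdd_belowI2[where m = 0] hamming_dist_nonneg)

lemma hamming_setdist_nonneg:
  assumes "\<And>i. i \<in> {1..n} \<Longrightarrow> 0 \<le> \<alpha> i" "A \<noteq> {}"
  shows "0 \<le> hamming_setdist n \<alpha> x A"
  unfolding hamming_setdist_def using assms by (intro cINF_greatest hamming_dist_nonneg)

lemma hamming_setdist_eq_0:
  assumes "\<And>i. i \<in> {1..n} \<Longrightarrow> 0 \<le> \<alpha> i" "x \<in> A"
  shows "hamming_setdist n \<alpha> x A = 0"
proof (rule antisym)
  show "hamming_setdist n \<alpha> x A \<le> 0"
    using hamming_setdist_lower[of n \<alpha> x A x] assms by (simp add: hamming_dist_def)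
  show "0 \<le> hamming_setdist n \<alpha> x A"
    using assms by (intro hamming_setdist_nonneg) auto
qed

text \<open>Taking the infimum over \<open>A\<close> in the triangle inequality gives one direction;
  symmetry gives the other.\<close>

lemma hamming_setdist_Lipschitz:
  assumes \<alpha>: "\<And>i. i \<in> {1..n} \<Longrightarrow> 0 \<le> \<alpha> i" and "A \<noteq> {}"
  shows "\<bar>hamming_setdist n \<alpha> x A - hamming_setdist n \<alpha> y A\<bar> \<le> hamming_dist n \<alpha> x y"
proof -
  have le: "hamming_setdist n \<alpha> x A - hamming_dist n \<alpha> x y \<le> hamming_setdist n \<alpha> y A" for x y
    unfolding hamming_setdist_def[of n \<alpha> y]
  proof (rule cINF_greatest[OF \<open>A \<noteq> {}\<close>])
    fix z assume "z \<in> A"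
    then have "hamming_setdist n \<alpha> x A \<le> hamming_dist n \<alpha> x z"
      using \<alpha> by (intro hamming_setdist_lower)
    also have "\<dots> \<le> hamming_dist n \<alpha> x y + hamming_dist n \<alpha> y z"
      using \<alpha> by (rule hamming_dist_triangle)
    finally show "hamming_setdist n \<alpha> x A - hamming_dist n \<alpha> x y \<le> hamming_dist n \<alpha> y z"
      by simp
  qed
  show ?thesis
    using le[of x y] le[of y x] by (simp add: hamming_dist_commute[of n \<alpha> y])
qed

section \<open>Numerical estimates\<close>

text \<open>As \<open>r \<ge> 0\<close> and the exponential is at least 1/2, the right side is at
  least \<open>sqrt (pi / 2) / 2\<close>. It remains to see that
  \<open>2 * t\<^sup>2 \<le> pi / 4\<close>, which the hypothesis on \<open>t\<close> gives.\<close>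

lemma le_of_exp_ge_half:
  fixes r t :: real
  assumes r: "exp (- 2 * r\<^sup>2) \<ge> 1 / 2" "r \<ge> 0" and t: "exp (- 2 * t\<^sup>2) \<ge> 1 / 2"
  shows "\<bar>t\<bar> \<le> (2 * r + sqrt (pi / 2)) * exp (- 2 * r\<^sup>2)"
proof -
  define s where "s = 2 * t\<^sup>2"
  have "exp s \<le> 2"
    using t by (simp add: s_def exp_minus field_simps)
  have "0 \<le> s" by (simp add: s_def)
  then have "1 + s + s\<^sup>2 / 2 \<le> 2"
    using exp_lower_Taylor_quadratic[of s] \<open>exp s \<le> 2\<close> by linarith
  have "s \<le> pi / 4"
  proof (rule ccontr)
    assume "\<not> s \<le> pi / 4"
    \<comment> \<open>At 3/4 the quadratic Taylor polynomial of the exponential already exceeds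
      2.\<close>
    then have "s \<ge> 3 / 4" using pi_gt3 by simp
    then have "s\<^sup>2 \<ge> (3 / 4)\<^sup>2" by (intro power_mono) auto
    with \<open>s \<ge> 3 / 4\<close> \<open>1 + s + s\<^sup>2 / 2 \<le> 2\<close> show False
      by (simp add: power2_eq_square)
  qed
  then have "(2 * \<bar>t\<bar>)\<^sup>2 \<le> pi / 2"
    by (simp add: s_def power_mult_distrib)
  then have "2 * \<bar>t\<bar> \<le> sqrt (pi / 2)"
    by (rule real_le_rsqrt)
  then have "\<bar>t\<bar> \<le> (2 * r + sqrt (pi / 2)) * (1 / 2)"
    using r(2) by simp
  also have "\<dots> \<le> (2 * r + sqrt (pi / 2)) * exp (- 2 * r\<^sup>2)"
    using r by (intro mult_left_mono) auto
  finally show ?thesis .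
qed

text \<open>The left-hand side is maximal for \<open>2 * r \<approx> 0.55347\<close>, where \<open>2 * r\<^sup>2 \<approx> 0.15316\<close>; the
  exponential is replaced by its tangent at 0.1532.\<close>

lemma linear_times_gaussian_less:
  fixes r :: real
  shows "(2 * r + sqrt (pi / 2)) * exp (- 2 * r\<^sup>2) < 1.5503"
proof -
  have "sqrt (pi / 2) \<le> 1.25332"
    using pi_approx(2) by (intro real_le_lsqrt) (auto simp: power2_eq_square)
  define s where "s = 2 * r\<^sup>2"
  \<comment> \<open>Here 0.01915 is 0.1532 / 8: the quadratic Taylor bound is applied at the smaller
    argument and raised to the eighth power for accuracy.\<close>
  have "1.1655 \<le> (1 + 0.01915 + 0.01915\<^sup>2 / 2 :: real) ^ 8"
    by (simp add: power2_eq_square eval_nat_numeral)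
  also have "\<dots> \<le> exp 0.01915 ^ 8"
    using exp_lower_Taylor_quadratic[of "0.01915 :: real"] by (intro power_mono) auto
  also have "\<dots> = exp (0.1532 :: real)"
    by (simp flip: exp_of_nat_mult)
  finally have e: "1.1655 \<le> exp (0.1532 :: real)" .
  have "2 * r + sqrt (pi / 2) < 1.5503 * (1.1655 * (1 + (s - 0.1532)))"
  proof -
    \<comment> \<open>Completing the square: with 1.25332 for the root, right side minus left side
      is this square divided by \<open>2 * 1.5503 * 1.1655\<close>, plus a positive constant of
      about 0.00002.\<close>
    have "0 \<le> (1.5503 * 1.1655 * (2 * r) - 1)\<^sup>2" by simp
    then show ?thesis
      using \<open>sqrt (pi / 2) \<le> 1.25332\<close> by (simp add: s_def power2_eq_square algebra_simps)
  qed
  also have "\<dots> \<le> 1.5503 * (exp 0.1532 * exp (s - 0.1532))"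
  proof -
    have "1 + (s - 0.1532) \<ge> 0" by (simp add: s_def)
    then show ?thesis
      using e by (intro mult_left_mono mult_mono exp_ge_add_one_self) auto
  qed
  also have "\<dots> = 1.5503 * exp s"
    by (simp flip: exp_add)
  finally show ?thesis
    by (simp add: s_def exp_minus field_simps)
qed

section \<open>The law of \<open>X\<close> as a product measure, and the conclusion\<close>

theorem theorem2p3:
  fixes n :: nat
    and E :: "'e measure"
    and M :: "'w measure"
    and X :: "'w \<Rightarrow> nat \<Rightarrow> 'e"
    and \<alpha> :: "nat \<Rightarrow> real"
    and f :: "(nat \<Rightarrow> 'e) \<Rightarrow> real"
    and m \<mu> \<rho> :: real
    and A :: "(nat \<Rightarrow> 'e) set"
  assumes "n \<ge> 1"
    and "prob_space M"
    and "X \<in> measurable M (power_space n E)"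
    and "prob_space.indep_vars M (\<lambda>_. E) (\<lambda>i \<omega>. X \<omega> i) {1..n}"
    and "\<And>i. i \<in> {1..n} \<Longrightarrow> 0 \<le> \<alpha> i"
    and "L2_set \<alpha> {1..n} = 1"
    and "f \<in> borel_measurable (power_space n E)"
    and "\<And>x x'. x \<in> space (power_space n E) \<Longrightarrow> x' \<in> space (power_space n E) \<Longrightarrow>
           \<bar>f x - f x'\<bar> \<le> hamming_dist n \<alpha> x x'"
    and "is_median M (\<lambda>\<omega>. f (X \<omega>)) m"
    and "\<mu> = prob_space.expectation M (\<lambda>\<omega>. f (X \<omega>))"
    and "A = {y \<in> space (power_space n E). f y \<le> m}"
    and "(\<lambda>x. hamming_setdist n \<alpha> x A) \<in> borel_measurable (power_space n E)"
    and "\<rho> = prob_space.expectation M (\<lambda>\<omega>. hamming_setdist n \<alpha> (X \<omega>) A)"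
  shows "\<bar>\<mu> - m\<bar> \<le> (2 * \<rho> + sqrt (pi / 2)) * exp (- 2 * \<rho>\<^sup>2) \<and>
         (2 * \<rho> + sqrt (pi / 2)) * exp (- 2 * \<rho>\<^sup>2) < 1.5503"
proof -
  note \<alpha> = assms(5) and lip = assms(8)
  note [measurable] = assms(3,7,12)
  interpret prob_space M by fact
  have rv: "(\<lambda>\<omega>. X \<omega> i) \<in> measurable M E" if "i \<in> {1..n}" for i
    using that by measurable
  \<comment> \<open>Indices outside \<open>{1..n}\<close> are irrelevant, but the locale of product measures asks for a
     probability measure at every index.\<close>
  define N where "N i = distr M E (\<lambda>\<omega>. X \<omega> (if i \<in> {1..n} then i else 1))" for i
  have "prob_space (N i)" for i
    unfolding N_def using \<open>n \<ge> 1\<close> by (intro prob_space_distr rv) auto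
  then interpret N: product_prob_space N UNIV
    by (intro product_prob_spaceI) auto
  define P where "P = PiM {1..n} N"
  have sets_P [measurable_cong]: "sets P = sets (power_space n E)"
    unfolding P_def by (intro sets_PiM_cong) (auto simp: N_def)
  have space_P: "space P = space (power_space n E)"
    by (rule sets_eq_imp_space_eq[OF sets_P])
  \<comment> \<open>Independence makes the joint law the product of the marginals. That fact
    concerns the restriction of \<open>X \<omega>\<close> to \<open>{1..n}\<close>, which is
    \<open>X \<omega>\<close> itself by extensionality.\<close>
  have distr_X: "distr M P X = P"
  proof -
    have "distr M P X = distr M (power_space n E) (\<lambda>\<omega>. \<lambda>i\<in>{1..n}. X \<omega> i)"
    proof (rule distr_cong)
      fix \<omega> assume "\<omega> \<in> space M"
      then have "X \<omega> \<in> space (power_space n E)"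
        by (rule measurable_space[OF assms(3)])
      then show "X \<omega> = (\<lambda>i\<in>{1..n}. X \<omega> i)"
        by (simp add: space_PiM PiE_restrict)
    qed (use sets_P in auto)
    also have "\<dots> = PiM {1..n} (\<lambda>i. distr M E (\<lambda>\<omega>. X \<omega> i))"
      using assms(4) rv \<open>n \<ge> 1\<close> by (subst (asm) indep_vars_iff_distr_eq_PiM') auto
    also have "\<dots> = P"
      unfolding P_def by (rule PiM_cong) (auto simp: N_def)
    finally show ?thesis .
  qed
  have integral_P: "integral\<^sup>L P h = expectation (\<lambda>\<omega>. h (X \<omega>))"
    if [measurable]: "h \<in> borel_measurable P" for h :: "_ \<Rightarrow> real"
    by (subst distr_X[symmetric], rule integral_distr) measurable
  \<comment> \<open>The inverted McDiarmid bound, moved from the product measure \<open>P\<close> to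
    the random vector \<open>X\<close>.\<close>
  have half: "exp (- 2 * (a - expectation (\<lambda>\<omega>. h (X \<omega>)))\<^sup>2) \<ge> 1 / 2"
    if h [measurable]: "h \<in> borel_measurable (power_space n E)"
      and lip_h: "\<And>x y. x \<in> space (power_space n E) \<Longrightarrow> y \<in> space (power_space n E) \<Longrightarrow>
                    \<bar>h x - h y\<bar> \<le> hamming_dist n \<alpha> x y"
      and prob: "prob {\<omega> \<in> space M. h (X \<omega>) \<ge> a} \<ge> 1 / 2"
      and a: "expectation (\<lambda>\<omega>. h (X \<omega>)) \<le> a"
    for h :: "(nat \<Rightarrow> 'e) \<Rightarrow> real" and a
  proof -
    have hP: "h \<in> borel_measurable P" by measurable
    have "measure P {x \<in> space P. h x \<ge> a} = measure (distr M P X) {x \<in> space P. h x \<ge> a}"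
      by (simp add: distr_X)
    also have "\<dots> = prob (X -` {x \<in> space P. h x \<ge> a} \<inter> space M)"
      by (rule measure_distr) measurable
    also have "X -` {x \<in> space P. h x \<ge> a} \<inter> space M = {\<omega> \<in> space M. h (X \<omega>) \<ge> a}"
      using measurable_space[OF assms(3)] by (auto simp: space_P)
    finally have "measure P {x \<in> space P. h x \<ge> a} \<ge> 1 / 2"
      using prob by simp
    moreover have "integral\<^sup>L P h = expectation (\<lambda>\<omega>. h (X \<omega>))"
      by (rule integral_P[OF hP])
    ultimately show ?thesis
      using N.exp_ge_half_of_Lipschitz[of "{1..n}" \<alpha> h a] \<alpha> assms(6) hP lip_h a
      unfolding P_def[symmetric] space_P hamming_dist_def by simp
  qed
  have ge: "prob {\<omega> \<in> space M. f (X \<omega>) \<ge> m} \<ge> 1 / 2" and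
       le: "prob {\<omega> \<in> space M. f (X \<omega>) \<le> m} \<ge> 1 / 2"
    using assms(9) by (auto simp: is_median_def)
  \<comment> \<open>The bound is one-sided: the half of the median condition to use depends on the
    side of \<open>m\<close> on which the mean lies.\<close>
  have 1: "exp (- 2 * (\<mu> - m)\<^sup>2) \<ge> 1 / 2"
  proof (cases "\<mu> \<le> m")
    case True
    then show ?thesis
      using half[of f m] assms(7) lip ge by (simp add: assms(10) power2_commute)
  next
    case False
    then show ?thesis
      using half[of "\<lambda>x. - f x" "- m"] borel_measurable_uminus[OF assms(7)] lip le
      by (simp add: assms(10) abs_minus_commute)
  qed
  \<comment> \<open>Needed for the infimum over \<open>A\<close> to be a genuine distance; it holds
    since \<open>f (X \<omega>) \<le> m\<close> has positive probability.\<close>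
  have A: "A \<noteq> {}"
  proof
    assume "A = {}"
    then have "{\<omega> \<in> space M. f (X \<omega>) \<le> m} = {}"
      using measurable_space[OF assms(3)] by (auto simp: assms(11))
    with le show False by simp
  qed
  have nonneg: "0 \<le> \<rho>"
    unfolding assms(13) using \<alpha> A by (intro Bochner_Integration.integral_nonneg hamming_setdist_nonneg) auto
  \<comment> \<open>Where \<open>f (X \<omega>) \<le> m\<close>, the point lies in \<open>A\<close>
    at distance 0. So the negated distance, of mean \<open>- \<rho>\<close>, reaches 0 with
    probability at least 1/2.\<close>
  have "prob {\<omega> \<in> space M. f (X \<omega>) \<le> m} \<le> prob {\<omega> \<in> space M. - hamming_setdist n \<alpha> (X \<omega>) A \<ge> 0}"
  proof (rule finite_measure_mono)
    show "{\<omega> \<in> space M. f (X \<omega>) \<le> m} \<subseteq> {\<omega> \<in> space M. - hamming_setdist n \<alpha> (X \<omega>) A \<ge> 0}"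
    proof safe
      fix \<omega> assume "\<omega> \<in> space M" "f (X \<omega>) \<le> m"
      then have "X \<omega> \<in> A"
        using measurable_space[OF assms(3)] by (simp add: assms(11))
      then show "0 \<le> - hamming_setdist n \<alpha> (X \<omega>) A"
        using \<alpha> by (subst hamming_setdist_eq_0) auto
    qed
  qed measurable
  then have 2: "exp (- 2 * \<rho>\<^sup>2) \<ge> 1 / 2"
    using half[of "\<lambda>x. - hamming_setdist n \<alpha> x A" 0] hamming_setdist_Lipschitz[of n \<alpha> A] \<alpha> A le nonneg
      borel_measurable_uminus[OF assms(12)]
    by (simp add: abs_minus_commute flip: assms(13))
  show ?thesis
    using le_of_exp_ge_half[OF 2 nonneg 1] linear_times_gaussian_less by blast
qed

end
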